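(* Let $n=p_1^{n_1}p_2^{n_2}\cdots p_r^{n_r}$, where $r\geq 3$, $n_1,\ldots,n_r$ are positive integers and $p_1<p_2<\cdots<p_r$ are prime numbers. Then $\kappa(\mathcal{P}(C_n))\leq \gamma(n)$, where $$\gamma(n)= \phi(n)+\frac{n}{p_1\cdots p_r}\left[\phi(p_1\cdots p_{r-1})+ \phi(p_1\cdots p_{r-2}p_r)+p_1\cdots p_{r-2}-\phi(p_1\cdots p_{r-2})\right].$$
   Context: $C_n$ is the cyclic group of order $n$ and $\phi$ is Euler's totient function. The power graph $\mathcal{P}(G)$ of a finite group $G$ is the simple undirected graph with vertex set $G$ in which two distinct vertices $x,y$ are adjacent if and only if $x\in\langle y\rangle$ or $y\in\langle x\rangle$. The vertex connectivity $\kappa(\Gamma)$ of a graph $\Gamma$ is the minimum number of vertices which need to be removed so that the induced subgraph on the remaining vertices is disconnected or has only one vertex. *)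

theory Defs
  imports
    "HOL-Algebra.Elementary_Groups"
    "HOL-Number_Theory.Totient"
    "Graph_Theory.Digraph_Component"
begin

text \<open>
  Following \<open>Graph_Theory\<close>, a simple undirected graph is a digraph satisfying the locale
  \<open>graph\<close>: finite, without loops or multiple arcs, and symmetric, every undirected edge
  being represented by its two orientations.
\<close>

definition power_graph :: "('a, 'b) monoid_scheme \<Rightarrow> ('a, 'a \<times> 'a) pre_digraph" where
  "power_graph G =
     \<lparr>verts = carrier G,
      arcs = {(x, y). x \<in> carrier G \<and> y \<in> carrier G \<and> x \<noteq> y \<and>
                      (x \<in> generate G {y} \<or> y \<in> generate G {x})},
      tail = fst, head = snd\<rparr>"

lemma graph_power_graph:
  assumes "finite (carrier G)"
  shows "graph (power_graph G)"
proof -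
  have "finite (arcs (power_graph G))"
    by (rule finite_subset [of _ "carrier G \<times> carrier G"])
      (use assms in \<open>auto simp: power_graph_def\<close>)
  with assms show ?thesis
    by unfold_locales
      (auto simp: power_graph_def arc_to_ends_def symmetric_conv)
qed

text \<open>
  Removed sets are proper subsets of the vertex set, so at least one vertex always remains;
  this matters because \<open>connected\<close> is false of the graph without vertices. For a finite
  nonempty graph a suitable removed set exists, since all vertices but one can be removed.
\<close>

definition vertex_connectivity :: "('a, 'b) pre_digraph \<Rightarrow> nat" where
  "vertex_connectivity \<Gamma> =
     (LEAST k. \<exists>S. S \<subset> verts \<Gamma> \<and> card S = k \<and>
        (\<not> Digraph_Component.connected (\<Gamma> \<restriction> (verts \<Gamma> - S)) \<or>
         card (verts (\<Gamma> \<restriction> (verts \<Gamma> - S))) = 1))"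

text \<open>
  The primes \<open>p 1 < \<dots> < p r\<close> dividing \<open>n\<close> are passed explicitly.
\<close>

definition gamma_bound :: "nat \<Rightarrow> (nat \<Rightarrow> nat) \<Rightarrow> nat \<Rightarrow> real" where
  "gamma_bound r p n =
     real (totient n) +
     real n / real (\<Prod>i = 1..r. p i) *
       (real (totient (\<Prod>i = 1..r - 1. p i)) +
        real (totient ((\<Prod>i = 1..r - 2. p i) * p r)) +
        real (\<Prod>i = 1..r - 2. p i) -
        real (totient (\<Prod>i = 1..r - 2. p i)))"

end

theory Submission
  imports Defs "HOL-Algebra.Multiplicative_Group"
begin

text \<open>
  Put \<open>p = p\<^bsub>r-1\<^esub>\<close>, \<open>q = p\<^bsub>r\<^esub>\<close> and \<open>P = p\<^bsub>1\<^esub>\<dots>p\<^bsub>r-2\<^esub>\<close>, fix a generator \<open>g\<close> of \<open>C\<^bsub>n\<^esub>\<close>, and let \<open>A\<close>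
  consist of the \<open>g\<^sup>k\<close> with \<open>k\<close> divisible by \<open>pq\<close> and coprime to \<open>P\<close>. If \<open>g\<^sup>i\<close> is a power of
  \<open>g\<^sup>j\<close>, then every divisor of \<open>n\<close> that divides \<open>j\<close> also divides \<open>i\<close>. So every neighbour of
  \<open>A\<close> outside \<open>A\<close> has an exponent that is coprime to \<open>P\<close> or divisible by \<open>pq\<close>. Removing all
  of these cuts \<open>A\<close> off from \<open>g\<^sup>P\<close>, and their number is \<open>\<gamma>(n)\<close> by inclusion and exclusion.
\<close>

section \<open>Disconnecting a graph by deleting vertices\<close>

text \<open>\<open>connected\<close> is reachability in the symmetric closure, and each arc,
  traversed either way, preserves membership in \<open>A\<close>. So no walk from \<open>u\<close>
  leaves \<open>A\<close>.\<close>

lemma not_connected_if_union_of_components: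
  assumes "u \<in> verts \<Gamma>" "v \<in> verts \<Gamma>" "u \<in> A" "v \<notin> A"
    and closed: "\<And>a. a \<in> arcs \<Gamma> \<Longrightarrow> tail \<Gamma> a \<in> A \<longleftrightarrow> head \<Gamma> a \<in> A"
  shows "\<not> Digraph_Component.connected \<Gamma>"
proof
  assume "Digraph_Component.connected \<Gamma>"
  then have "u \<rightarrow>\<^sup>*\<^bsub>with_proj (mk_symmetric \<Gamma>)\<^esub> v"
    using assms(1,2) by (simp add: connected_def strongly_connected_def)
  then have "(u, v) \<in> (parcs (mk_symmetric \<Gamma>))\<^sup>*"
    by (auto simp: reachable_def dest: rtrancl_on_rtranclI)
  then have "v \<in> A"
    by (induction rule: rtrancl_induct)
      (use \<open>u \<in> A\<close> closed in \<open>auto simp: parcs_mk_symmetric\<close>)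
  with \<open>v \<notin> A\<close> show False ..
qed

lemma vertex_connectivity_le_card:
  assumes "S \<subset> verts \<Gamma>" "\<not> Digraph_Component.connected (\<Gamma> \<restriction> (verts \<Gamma> - S))"
  shows "vertex_connectivity \<Gamma> \<le> card S"
  unfolding vertex_connectivity_def by (rule Least_le) (use assms in blast)

section \<open>Counting exponents by divisibility and coprimality\<close>

text \<open>Coprimality to \<open>D\<close> has period \<open>D\<close>, and the interval consists
  of \<open>m\<close> full periods, each contributing a translate of
  \<open>totatives D\<close>.\<close>

lemma card_coprime_upto_mult:
  "card {k \<in> {0<..m * D}. coprime k D} = m * totient (D::nat)"
proof (induction m)
  case (Suc m)
  have shift: "coprime (m * D + j) D \<longleftrightarrow> coprime j D" for j
    by (simp add: coprime_iff_gcd_eq_1 gcd.commute[of _ D] gcd_add_mult)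
  have "{k \<in> {0<..Suc m * D}. coprime k D} =
        {k \<in> {0<..m * D}. coprime k D} \<union> (+) (m * D) ` totatives D" (is "?L = ?A \<union> ?B")
  proof (intro equalityI subsetI)
    fix k assume k: "k \<in> ?L"
    show "k \<in> ?A \<union> ?B"
    proof (cases "k \<le> m * D")
      case False
      define j where "j = k - m * D"
      have kj: "k = m * D + j" using False by (simp add: j_def)
      have "coprime j D" using k by (simp add: kj shift)
      then have "j \<in> totatives D"
        using k False by (auto simp: in_totatives_iff kj)
      then show ?thesis by (auto simp: kj)
    qed (use k in auto)
  next
    fix k assume "k \<in> ?A \<union> ?B"
    then show "k \<in> ?L"
      by (auto simp: in_totatives_iff shift)
  qed
  moreover have "?A \<inter> ?B = {}" by (auto simp: in_totatives_iff)
  moreover have "card ?B = totient D"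
    by (simp add: card_image totient_def)
  ultimately show ?case
    using Suc by (simp add: card_Un_disjoint)
qed simp

text \<open>Writing \<open>k = d * j\<close> reduces this to the previous count: as \<open>d\<close>
  is coprime to \<open>D\<close>, the condition on \<open>k\<close> becomes the same condition on
  \<open>j\<close>.\<close>

lemma card_multiples_coprime_upto_mult:
  fixes D d :: nat
  assumes "d > 0" "coprime d D"
  shows "card {k \<in> {0<..m * (D * d)}. d dvd k \<and> coprime k D} = m * totient D"
proof -
  have "{k \<in> {0<..m * (D * d)}. d dvd k \<and> coprime k D} =
        (*) d ` {k \<in> {0<..m * D}. coprime k D}" (is "?L = ?R")
  proof (intro equalityI subsetI)
    fix k assume k: "k \<in> ?L"
    then obtain j where j: "k = d * j" by auto
    have "d * j \<le> d * (m * D)" using k by (simp add: j mult_ac)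
    then have "j \<le> m * D" using assms by simp
    then show "k \<in> ?R" using k by (auto simp: j)
  next
    fix k assume "k \<in> ?R"
    then obtain j where j: "k = d * j" "j > 0" "j \<le> m * D" "coprime j D" by auto
    have "d * j \<le> d * (m * D)" using j(3) by simp
    then show "k \<in> ?L" using j assms by (simp add: mult_ac)
  qed
  moreover have "inj_on ((*) d) {k \<in> {0<..m * D}. coprime k D}"
    using assms by (auto simp: inj_on_def)
  ultimately show ?thesis
    by (simp only: card_image card_coprime_upto_mult)
qed

section \<open>Cyclic groups and a cut of their power graph\<close>

context group
begin

text \<open>Exponents start at 1, so the identity has exponent \<open>order G\<close>; this matches
  the intervals in the counting lemmas.\<close>

lemma cyclic_group_pow_bij_betw:
  assumes "cyclic_group G" "order G > 0"
  obtains g where "g \<in> carrier G" "ord g = order G"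
    "bij_betw (\<lambda>k::nat. g [^] k) {0<..order G} (carrier G)"
proof -
  obtain g where g: "g \<in> carrier G" and gen: "subgroup_generated G {g} = G"
    using assms(1) by (auto simp: cyclic_group_def)
  have fin: "finite (carrier G)"
    using assms(2) order_gt_0_iff_finite by blast
  have "carrier G = generate G {g}"
    using gen g by (metis carrier_subgroup_generated Int_insert_right_if1 Int_empty_right)
  then have ord: "ord g = order G"
    using generate_pow_card[OF g] by (simp add: order_def)
  have inj: "inj_on (\<lambda>k::nat. g [^] k) {0<..order G}"
    using ord_inj'[OF g] by (simp add: ord atLeastSucAtMost_greaterThanAtMost)
  moreover have "(\<lambda>k::nat. g [^] k) ` {0<..order G} = carrier G"
  proof (rule card_subset_eq[OF fin])
    show "(\<lambda>k::nat. g [^] k) ` {0<..order G} \<subseteq> carrier G"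
      using g by auto
    show "card ((\<lambda>k::nat. g [^] k) ` {0<..order G}) = card (carrier G)"
      using card_image[OF inj] by (simp add: order_def)
  qed
  ultimately show thesis
    using that g ord by (simp add: bij_betw_def)
qed

text \<open>For some integer \<open>z\<close>, \<open>i\<close> is congruent to \<open>j * z\<close>
  modulo \<open>ord g\<close>, hence modulo its divisor \<open>d\<close>, which divides
  \<open>j\<close>.\<close>

lemma dvd_if_pow_in_generate_pow:
  fixes i j d :: nat
  assumes g: "g \<in> carrier G" and "g [^] i \<in> generate G {g [^] j}"
    and "d dvd ord g" "d dvd j"
  shows "d dvd i"
proof -
  obtain z :: int where "g [^] i = (g [^] j) [^] z"
    using assms(2) g by (auto simp: generate_pow)
  then have "g [^] int i = g [^] (int j * z)"
    using g by (simp add: int_pow_int int_pow_pow flip: int_pow_int)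
  then have "int (ord g) dvd int j * z - int i"
    using g by (simp add: int_pow_eq)
  then have "int d dvd int j * z - int i"
    using assms(3) by (meson dvd_trans int_dvd_int_iff)
  moreover have "int d dvd int j * z"
    using assms(4) by simp
  ultimately have "int d dvd int i"
    by (metis dvd_diff_right_iff)
  then show ?thesis by simp
qed

text \<open>The bound is \<open>card C + card M - 2 * card A\<close> for the sets defined below,
  with the negative term moved to the left to avoid truncated subtraction.\<close>

lemma vertex_connectivity_power_graph_cyclic_le:
  fixes P p q m :: nat
  assumes cyc: "cyclic_group G" and ord_G: "order G = m * (P * p * q)" and "m > 0" "P > 1"
    and pq: "prime p" "prime q" and cop: "coprime p P" "coprime q P"
  shows "vertex_connectivity (power_graph G) + 2 * (m * totient P)
    \<le> m * (p * q * totient P + P)"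
proof -
  define n where "n = order G"
  have n: "n = m * (P * p * q)" and "n > 0"
    using ord_G assms prime_gt_0_nat by (auto simp: n_def)
  obtain g where g: "g \<in> carrier G" and ord_g: "ord g = n"
    and bij: "bij_betw (\<lambda>k::nat. g [^] k) {0<..n} (carrier G)"
    using cyclic_group_pow_bij_betw[OF cyc] \<open>n > 0\<close> by (auto simp: n_def)
  define f where "f = (\<lambda>k::nat. g [^] k)"
  have inj: "inj_on f {0<..n}" and img: "f ` {0<..n} = carrier G"
    using bij by (auto simp: f_def bij_betw_def)
  define C where "C = {k \<in> {0<..n}. coprime k P}"
  define M where "M = {k \<in> {0<..n}. p * q dvd k}"
  define A where "A = C \<inter> M"
  \<comment> \<open>This is the symmetric difference of \<open>C\<close> and \<open>M\<close>, so
    off \<open>T\<close> membership in \<open>A\<close>, in \<open>C\<close> and in \<open>M\<close>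
    are equivalent.\<close>
  define T where "T = C \<union> M - A"
  have sub: "C \<subseteq> {0<..n}" "M \<subseteq> {0<..n}" "A \<subseteq> {0<..n}" "T \<subseteq> {0<..n}"
    by (auto simp: C_def M_def A_def T_def)
  have fin: "finite C" "finite M" "finite A"
    using sub by (auto intro: finite_subset)

  have "P > 0" "p > 0" "q > 0" using assms prime_gt_0_nat by auto
  have cop_pq: "coprime (p * q) P" using cop by simp
  have P_le: "P \<le> n" and pq_le: "p * q \<le> n"
    using \<open>n > 0\<close> by (auto simp: n intro!: dvd_imp_le dvd_mult)
  \<comment> \<open>The exponents \<open>P\<close> and \<open>p * q\<close> will witness the two
    sides of the cut.\<close>
  have "P \<notin> C" using \<open>P > 1\<close> by (auto simp: C_def)
  have "P \<notin> M"
  proof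
    assume "P \<in> M"
    then have "p dvd P" by (auto simp: M_def dest: dvd_mult_left)
    then show False using cop(1) pq(1) by (metis coprime_absorb_left not_prime_unit)
  qed
  have "p * q \<in> A" using pq_le cop_pq \<open>p > 0\<close> \<open>q > 0\<close> by (simp add: A_def C_def M_def)

  \<comment> \<open>Divisors of \<open>n\<close> pass from \<open>j\<close> to \<open>i\<close>.
    Hence coprimality to \<open>P\<close> passes from \<open>i\<close> to \<open>j\<close>, and
    divisibility by \<open>p * q\<close> from \<open>j\<close> to \<open>i\<close>. Off
    \<open>T\<close> the former gives one implication for \<open>A\<close>, the latter the
    other.\<close>
  have step: "i \<in> A \<longleftrightarrow> j \<in> A"
    if ij: "i \<in> {0<..n} - T" "j \<in> {0<..n} - T" and "f i \<in> generate G {f j}" for i j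
  proof -
    have dvd: "d dvd i" if "d dvd n" "d dvd j" for d
      using dvd_if_pow_in_generate_pow[OF g] that \<open>f i \<in> generate G {f j}\<close> ord_g
      by (auto simp: f_def)
    have "j \<in> C" if "i \<in> C"
    proof -
      have "coprime j P"
      proof (rule coprimeI)
        fix d assume "d dvd j" "d dvd P"
        then have "d dvd i" using dvd by (simp add: n)
        then show "is_unit d" using \<open>d dvd P\<close> \<open>i \<in> C\<close>
          unfolding C_def by (blast intro: coprime_common_divisor)
      qed
      then show ?thesis using ij by (simp add: C_def)
    qed
    moreover have "i \<in> M" if "j \<in> M"
      using dvd[of "p * q"] that ij by (auto simp: M_def n mult_ac)
    ultimately show ?thesis using ij by (auto simp: A_def T_def)
  qed

  define S where "S = f ` T"
  have f_in: "f k \<in> S \<longleftrightarrow> k \<in> T" "f k \<in> f ` A \<longleftrightarrow> k \<in> A" if "k \<in> {0<..n}" for k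
    using inj sub that by (simp_all add: S_def inj_on_image_mem_iff)
  have in_n: "P \<in> {0<..n}" "p * q \<in> {0<..n}"
    using P_le \<open>P > 0\<close> \<open>p * q \<in> A\<close> sub by auto
  have not_T: "P \<notin> T" "p * q \<notin> T"
    using \<open>P \<notin> C\<close> \<open>P \<notin> M\<close> \<open>p * q \<in> A\<close> by (auto simp: T_def)
  have verts: "verts (power_graph G) = carrier G" by (simp add: power_graph_def)
  have "S \<subset> carrier G"
    using f_in(1)[OF in_n(1)] in_n not_T sub by (auto simp: S_def simp flip: img)
  moreover have "\<not> Digraph_Component.connected (power_graph G \<restriction> (carrier G - S))"
  proof (rule not_connected_if_union_of_components)
    show "f (p * q) \<in> verts (power_graph G \<restriction> (carrier G - S))"
      "f P \<in> verts (power_graph G \<restriction> (carrier G - S))"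
      using in_n not_T by (auto simp: f_in simp flip: img)
    show "f (p * q) \<in> f ` A" using \<open>p * q \<in> A\<close> by simp
    show "f P \<notin> f ` A" using f_in(2)[OF in_n(1)] \<open>P \<notin> C\<close> by (simp add: A_def)
    fix a assume "a \<in> arcs (power_graph G \<restriction> (carrier G - S))"
    then obtain x y where a: "a = (x, y)" and xy: "x \<in> carrier G - S" "y \<in> carrier G - S"
      and adj: "x \<in> generate G {y} \<or> y \<in> generate G {x}"
      by (auto simp: power_graph_def)
    obtain i j where i: "i \<in> {0<..n}" "x = f i" and j: "j \<in> {0<..n}" "y = f j"
      using xy by (auto simp flip: img)
    have "i \<in> {0<..n} - T" "j \<in> {0<..n} - T" using xy i j f_in by auto
    then have "i \<in> A \<longleftrightarrow> j \<in> A" using adj step i(2) j(2) by blast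
    then show "tail (power_graph G \<restriction> (carrier G - S)) a \<in> f ` A \<longleftrightarrow>
        head (power_graph G \<restriction> (carrier G - S)) a \<in> f ` A"
      using i j f_in(2) by (simp add: a power_graph_def)
  qed
  ultimately have "vertex_connectivity (power_graph G) \<le> card S"
    using vertex_connectivity_le_card[of S "power_graph G"] by (simp add: verts)
  also have "card S = card T"
    using inj sub by (auto simp: S_def intro: card_image inj_on_subset)
  finally have "vertex_connectivity (power_graph G) \<le> card T" .
  moreover have "card T + 2 * card A = card C + card M"
  proof -
    have "card T + card A = card (C \<union> M)"
      using fin by (simp add: T_def card_Diff_subset A_def card_mono le_supI1 flip: le_add_diff_inverse2)
    then show ?thesis using card_Un_Int[OF fin(1,2)] by (simp add: A_def)
  qed
  moreover have "card C = m * (p * q * totient P)"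
    using card_coprime_upto_mult[of "m * (p * q)" P] by (simp add: C_def n mult_ac)
  \<comment> \<open>With \<open>D = 1\<close> the coprimality condition is vacuous.\<close>
  moreover have "card M = m * P"
    using card_multiples_coprime_upto_mult[of "p * q" 1 "m * P"] \<open>p > 0\<close> \<open>q > 0\<close>
    by (simp add: M_def n mult_ac)
  moreover have "A = {k \<in> {0<..m * (P * (p * q))}. p * q dvd k \<and> coprime k P}"
    by (auto simp: A_def C_def M_def n mult_ac)
  then have "card A = m * totient P"
    using card_multiples_coprime_upto_mult[OF _ cop_pq] \<open>p > 0\<close> \<open>q > 0\<close> by simp
  ultimately show ?thesis by (simp add: algebra_simps)
qed

end

section \<open>Comparison with \<open>gamma_bound\<close>\<close>

text \<open>By hypothesis \<open>m\<close> brings no new prime, so the totatives of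
  \<open>m * D\<close> are the numbers coprime to \<open>D\<close> in \<open>m\<close>
  periods.\<close>

lemma totient_mult_same_prime_divisors:
  fixes m D :: nat
  assumes "\<And>k. coprime k D \<Longrightarrow> coprime k m"
  shows "totient (m * D) = m * totient D"
proof -
  have "totatives (m * D) = {k \<in> {0<..m * D}. coprime k D}"
    using assms by (auto simp: in_totatives_iff)
  then show ?thesis by (metis card_coprime_upto_mult totient_def)
qed

theorem theorem1p1:
  fixes G :: "('a, 'b) monoid_scheme"
    and n r :: nat
    and p e :: "nat \<Rightarrow> nat"
  assumes "r \<ge> 3"
    and "\<And>i. i \<in> {1..r} \<Longrightarrow> prime (p i)"
    and "strict_mono_on {1..r} p"
    and "\<And>i. i \<in> {1..r} \<Longrightarrow> e i > 0"
    and "n = (\<Prod>i = 1..r. p i ^ e i)"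
    and "group G" and "cyclic_group G" and "order G = n"
  shows "real (vertex_connectivity (power_graph G)) \<le> gamma_bound r p n"
proof -
  interpret group G by fact
  \<comment> \<open>With \<open>r = Suc (Suc s)\<close> the last two factors split off the products
    by simplification.\<close>
  define s where "s = r - 2"
  have r: "r = Suc (Suc s)" and "s \<ge> 1" using assms(1) by (auto simp: s_def)
  define P where "P = (\<Prod>i = 1..s. p i)"
  define a where "a = p (Suc s)"
  define b where "b = p (Suc (Suc s))"
  \<comment> \<open>This is \<open>n\<close> divided by its distinct primes; the truncated
    \<open>e i - 1\<close> is exact because \<open>e i > 0\<close>.\<close>
  define m where "m = (\<Prod>i = 1..r. p i ^ (e i - 1))"
  have prime_p: "prime (p i)" if "1 \<le> i" "i \<le> r" for i using assms(2) that by simp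
  have prods: "(\<Prod>i = 1..r. p i) = P * a * b" "(\<Prod>i = 1..r - 1. p i) = P * a"
    by (simp_all add: r P_def a_def b_def)
  have n: "n = m * (P * a * b)"
    unfolding assms(5) m_def prods(1)[symmetric] prod.distrib[symmetric]
    by (intro prod.cong refl) (use assms(4) in \<open>simp flip: power_Suc2\<close>)
  have cop_p: "coprime (p i) (p j)" if "1 \<le> i" "i < j" "j \<le> r" for i j
  proof (rule primes_coprime)
    show "p i \<noteq> p j"
      using strict_mono_onD[OF assms(3), of i j] that by simp
  qed (use that prime_p in auto)
  have ab: "prime a" "prime b" using prime_p by (auto simp: a_def b_def r)
  have cop: "coprime a b" "coprime a P" "coprime b P"
    using cop_p by (auto simp: a_def b_def r P_def coprime_commute intro!: prod_coprime_right)
  have "m > 0" using prime_p prime_gt_0_nat by (auto simp: m_def intro!: prod_pos)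
  \<comment> \<open>Here \<open>r \<ge> 3\<close> matters: it makes \<open>p 1\<close> a factor of
    \<open>P\<close>.\<close>
  have "P > 1"
  proof -
    have "p 1 dvd P" using \<open>s \<ge> 1\<close> by (auto simp: P_def intro!: dvd_prodI)
    moreover have "P > 0" using prime_p prime_gt_0_nat by (auto simp: P_def r intro!: prod_pos)
    ultimately show ?thesis
      using prime_gt_1_nat[OF prime_p[of 1]] assms(1) dvd_imp_le[of "p 1" P] by simp
  qed
  have tot_n: "totient n = m * totient (P * a * b)"
    unfolding n
  proof (rule totient_mult_same_prime_divisors)
    fix k assume k: "coprime k (P * a * b)"
    have "coprime k (p i)" if "i \<in> {1..r}" for i
      using k that dvd_prodI[of "{1..r}" i p] coprime_divisors[of k k "p i"]
      by (simp flip: prods(1))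
    then show "coprime k m" by (auto simp: m_def intro!: prod_coprime_right)
  qed
  have tot: "totient (P * a * b) = totient P * (a - 1) * (b - 1)"
    "totient (P * a) = totient P * (a - 1)" "totient (P * b) = totient P * (b - 1)"
    using cop ab by (simp_all add: totient_mult_coprime totient_prime coprime_commute)
  have "vertex_connectivity (power_graph G) + 2 * (m * totient P) \<le> m * (a * b * totient P + P)"
    by (rule vertex_connectivity_power_graph_cyclic_le)
      (use assms n ab cop \<open>m > 0\<close> \<open>P > 1\<close> in auto)
  then have "real (vertex_connectivity (power_graph G)) + 2 * (real m * real (totient P))
      \<le> real m * (real a * real b * real (totient P) + real P)"
    by (metis (mono_tags, lifting) of_nat_add of_nat_le_iff of_nat_mult of_nat_numeral)
  moreover have "real n / real (P * a * b) = real m"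
    using ab \<open>P > 1\<close> prime_gt_0_nat by (simp add: n)
  then have "gamma_bound r p n = real m * (real (totient P) * (real a - 1) * (real b - 1)) +
      real m * (real (totient P) * (real a - 1) + real (totient P) * (real b - 1)
        + real P - real (totient P))"
    using tot_n tot ab prime_ge_1_nat
    unfolding gamma_bound_def prods s_def[symmetric] P_def[symmetric]
    by (simp add: r b_def of_nat_diff)
  \<comment> \<open>Since \<open>(a - 1) * (b - 1) + (a - 1) + (b - 1) - 1 = a * b - 2\<close>, the
    value of \<open>gamma_bound\<close> is exactly the bound obtained from the cut.\<close>
  ultimately show ?thesis by (simp add: algebra_simps)
qed

end
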